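(* Chromaticities across a change in capture condition (light color, shading and imaging device) are a homography apart. That is, if $(r,g)$ and $(r',g')$ denote corresponding chromaticities before and after the change, then $[r'\;g']^\intercal=H([r\;g]^\intercal)$ for a homography $H(\cdot)$.
   Context: Chromaticity: the chromaticity coordinates of an RGB vector $[R\;G\;B]^\intercal$ are $r=R/(R+G+B)$ and $g=G/(R+G+B)$. Homography (row-vector convention): for a $3\times 3$ matrix $H$, writing $[x\;y]^\intercal=H([x'\;y']^\intercal)$ means that $[\alpha x\;\;\alpha y\;\;\alpha]=[x'\;y'\;1]\,H$ for a scalar $\alpha$, where a homogeneous vector $[a\;b\;c]^\intercal$ represents the point $[a/c\;\;b/c]^\intercal$, so that $\alpha$ cancels. Change in capture condition (modelling assumption): across a change in illumination or a change in imaging device where the shading is the same, corresponding RGBs (written as row vectors) are assumed to be related by a linear transform, i.e. a $3\times 3$ matrix $M$. Different shading additionally scales each color triple by an unknown scalar $\alpha'$, since shading only affects the magnitude of an RGB vector; the shading factors generally differ from pixel to pixel. *)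

theory Defs
  imports "HOL-Analysis.Analysis"
begin

text \<open>RGBs are row vectors, so matrices act from the right (\<open>v*\<close>).\<close>

definition rgb_sum :: "real ^ 3 \<Rightarrow> real" where
  "rgb_sum \<rho> = \<rho> $ 1 + \<rho> $ 2 + \<rho> $ 3"

text \<open>Meaningful only when the sum of the three responses is nonzero.\<close>

definition chromaticity :: "real ^ 3 \<Rightarrow> real ^ 2" where
  "chromaticity \<rho> = vector [\<rho> $ 1 / rgb_sum \<rho>, \<rho> $ 2 / rgb_sum \<rho>]"

text \<open>\<open>homography_maps H p q\<close> says \<open>q = H(p)\<close>. The factor \<open>\<alpha>\<close> is the third
  homogeneous coordinate, by which one divides; \<open>\<alpha> = 0\<close> represents no point of the plane.\<close>

definition homography_maps :: "real ^ 3 ^ 3 \<Rightarrow> real ^ 2 \<Rightarrow> real ^ 2 \<Rightarrow> bool" where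
  "homography_maps H p q \<longleftrightarrow>
     (\<exists>\<alpha>. \<alpha> \<noteq> 0 \<and>
        (vector [\<alpha> * q $ 1, \<alpha> * q $ 2, \<alpha>] :: real ^ 3) = vector [p $ 1, p $ 2, 1] v* H)"

text \<open>The matrix \<open>M\<close> models the change of light color and device and is common to all
  pixels; the shading factor \<open>s\<close> may differ from one pair of RGBs to the next.\<close>

definition corresponding_rgbs :: "real ^ 3 ^ 3 \<Rightarrow> real ^ 3 \<Rightarrow> real ^ 3 \<Rightarrow> bool" where
  "corresponding_rgbs M \<rho> \<rho>' \<longleftrightarrow> (\<exists>s. \<rho>' = s *\<^sub>R (\<rho> v* M))"

end

theory Submission
  imports Defs
begin

text \<open>With \<open>T\<close> the invertible matrix sending \<open>[R G B]\<close> to \<open>[R G R+G+B]\<close>, the row vector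
  \<open>[r g 1]\<close> is proportional to \<open>[R G B] T\<close>. Multiplication by \<open>M\<close> on RGBs thus becomes
  multiplication by \<open>T\<inverse> M T\<close> on homogeneous chromaticities, and
  the shading factor only affects the homogeneous scale.\<close>

definition rgb_to_rgsum :: "real ^ 3 ^ 3" where
  "rgb_to_rgsum = vector [vector [1, 0, 1], vector [0, 1, 1], vector [0, 0, 1]]"

definition rgsum_to_rgb :: "real ^ 3 ^ 3" where
  "rgsum_to_rgb = vector [vector [1, 0, -1], vector [0, 1, -1], vector [0, 0, 1]]"

lemma rgb_to_rgsum_inverse: "rgb_to_rgsum ** rgsum_to_rgb = mat 1"
  by (simp add: rgb_to_rgsum_def rgsum_to_rgb_def matrix_matrix_mult_def mat_def vec_eq_iff
      forall_3 sum_3)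

text \<open>The last column of \<open>rgb_to_rgsum\<close> produces \<open>rgb_sum \<rho>\<close>;
  as this is nonzero, scaling by it undoes the division in \<open>chromaticity\<close>.\<close>

lemma vector_matrix_mult_rgb_to_rgsum:
  assumes "rgb_sum \<rho> \<noteq> 0"
  shows "\<rho> v* rgb_to_rgsum =
    rgb_sum \<rho> *\<^sub>R vector [chromaticity \<rho> $ 1, chromaticity \<rho> $ 2, 1]"
  using assms
  by (simp add: rgb_to_rgsum_def chromaticity_def vector_matrix_mult_def vec_eq_iff
      forall_3 sum_3) (simp add: rgb_sum_def)

theorem theorem1:
  fixes M :: "real ^ 3 ^ 3"
  shows "\<exists>H :: real ^ 3 ^ 3. \<forall>\<rho> \<rho>'.
    corresponding_rgbs M \<rho> \<rho>' \<longrightarrow> rgb_sum \<rho> \<noteq> 0 \<longrightarrow> rgb_sum \<rho>' \<noteq> 0 \<longrightarrow>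
    homography_maps H (chromaticity \<rho>) (chromaticity \<rho>')"
proof (intro exI allI impI)
  fix \<rho> \<rho>' :: "real ^ 3"
  let ?T = rgb_to_rgsum
  \<comment> \<open>Built from \<open>M\<close> alone, so one matrix serves all pairs and all
    shading factors.\<close>
  let ?H = "rgsum_to_rgb ** M ** ?T"
  let ?h = "\<lambda>\<rho>. vector [chromaticity \<rho> $ 1, chromaticity \<rho> $ 2, 1] :: real ^ 3"
  assume "corresponding_rgbs M \<rho> \<rho>'" and nz: "rgb_sum \<rho> \<noteq> 0" and nz': "rgb_sum \<rho>' \<noteq> 0"
  then obtain s where s: "\<rho>' = s *\<^sub>R (\<rho> v* M)"
    by (auto simp: corresponding_rgbs_def)
  \<comment> \<open>For \<open>s = 0\<close>, \<open>\<rho>'\<close> would be the zero vector, whose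
    sum is 0.\<close>
  with nz' have "s \<noteq> 0"
    by (auto simp: rgb_sum_def)
  \<comment> \<open>The ratio of the two homogeneous scales: the chain below ends in
    \<open>rgb_sum \<rho>'\<close> and starts with \<open>s * rgb_sum \<rho>\<close>.\<close>
  define \<alpha> where "\<alpha> = rgb_sum \<rho>' / (s * rgb_sum \<rho>)"
  have "(s * rgb_sum \<rho>) *\<^sub>R (?h \<rho> v* ?H) = s *\<^sub>R ((\<rho> v* ?T) v* ?H)"
    by (simp add: vector_matrix_mult_rgb_to_rgsum[OF nz] scaleR_vector_matrix_assoc)
  \<comment> \<open>\<open>?T\<close> cancels against the leading factor \<open>rgsum_to_rgb\<close>
    of \<open>?H\<close>.\<close>
  also have "\<dots> = s *\<^sub>R ((\<rho> v* M) v* ?T)"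
    by (simp add: vector_matrix_mul_assoc matrix_mul_assoc rgb_to_rgsum_inverse)
  also have "\<dots> = \<rho>' v* ?T"
    by (simp add: s scaleR_vector_matrix_assoc)
  also have "\<dots> = rgb_sum \<rho>' *\<^sub>R ?h \<rho>'"
    by (rule vector_matrix_mult_rgb_to_rgsum[OF nz'])
  finally have "?h \<rho> v* ?H = \<alpha> *\<^sub>R ?h \<rho>'"
    using nz \<open>s \<noteq> 0\<close> by (simp add: \<alpha>_def vec_eq_iff field_simps)
  also have "\<alpha> *\<^sub>R ?h \<rho>' = vector [\<alpha> * chromaticity \<rho>' $ 1, \<alpha> * chromaticity \<rho>' $ 2, \<alpha>]"
    by (simp add: vec_eq_iff forall_3)
  finally have "?h \<rho> v* ?H = \<dots>" .
  moreover have "\<alpha> \<noteq> 0"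
    using nz nz' \<open>s \<noteq> 0\<close> by (simp add: \<alpha>_def)
  ultimately show "homography_maps ?H (chromaticity \<rho>) (chromaticity \<rho>')"
    unfolding homography_maps_def by metis
qed

end
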